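(* Let $M$ be a DFA with $n$ states such that $L = L(M)$ is not prefix-closed. Then a minimal witness $(v,w)$ to the failure of prefix-closure of $L$ satisfies $|w| \le n$. This is best possible: for every $n \ge 2$ there is a DFA with $n$ states whose language is not prefix-closed and whose minimal witness $(v,w)$ has $|w| = n$.
   Context: A word $v$ is a prefix of $w$ if $w = vx$ for some word $x$. $L$ is prefix-closed if $w \in L$ and $v$ a prefix of $w$ imply $v \in L$. A witness to the failure of prefix-closure is a pair $(v,w)$ with $w \in L$, $v \notin L$, $v$ a prefix of $w$. A witness $(v,w)$ is minimal if there is no witness $(v',w')$ with $|w'| < |w|$, or with $|w'| = |w|$ and $|v'| < |v|$. *)

theory Defs
  imports "HOL-Library.Sublist"
begin

record ('q, 'a) dfa =
  states :: "'q set"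
  alphabet :: "'a set"
  nxt :: "'q \<Rightarrow> 'a \<Rightarrow> 'q"
  init :: "'q"
  final :: "'q set"

text \<open>Automata are complete: the transition function is total on
  \<open>states M \<times> alphabet M\<close>; its values elsewhere are irrelevant.\<close>

definition is_dfa :: "('q, 'a) dfa \<Rightarrow> bool" where
  "is_dfa M \<longleftrightarrow>
     finite (states M) \<and> finite (alphabet M) \<and>
     init M \<in> states M \<and> final M \<subseteq> states M \<and>
     (\<forall>q\<in>states M. \<forall>a\<in>alphabet M. nxt M q a \<in> states M)"

definition language :: "('q, 'a) dfa \<Rightarrow> 'a list set" where
  "language M = {w \<in> lists (alphabet M). foldl (nxt M) (init M) w \<in> final M}"

definition prefix_closed :: "'a list set \<Rightarrow> bool" where
  "prefix_closed L \<longleftrightarrow> (\<forall>w v. w \<in> L \<and> prefix v w \<longrightarrow> v \<in> L)"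

definition prefix_witness :: "'a list set \<Rightarrow> 'a list \<Rightarrow> 'a list \<Rightarrow> bool" where
  "prefix_witness L v w \<longleftrightarrow> w \<in> L \<and> v \<notin> L \<and> prefix v w"

definition minimal_prefix_witness :: "'a list set \<Rightarrow> 'a list \<Rightarrow> 'a list \<Rightarrow> bool" where
  "minimal_prefix_witness L v w \<longleftrightarrow>
     prefix_witness L v w \<and>
     (\<nexists>v' w'. prefix_witness L v' w' \<and>
        (length w' < length w \<or> length w' = length w \<and> length v' < length v))"

lemma minimal_prefix_witness_exists:
  assumes "\<not> prefix_closed L"
  shows "\<exists>v w. minimal_prefix_witness L v w"
proof -
  let ?W = "\<lambda>n m. \<exists>v w. prefix_witness L v w \<and> length w = n \<and> length v = m"
  have "\<exists>n m. ?W n m"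
    using assms by (auto simp: prefix_closed_def prefix_witness_def)
  then obtain n where n: "\<exists>m. ?W n m" "\<And>n'. n' < n \<Longrightarrow> \<not> (\<exists>m. ?W n' m)"
    using exists_least_iff[of "\<lambda>n. \<exists>m. ?W n m"] by auto
  from n(1) obtain m where m: "?W n m" "\<And>m'. m' < m \<Longrightarrow> \<not> ?W n m'"
    using exists_least_iff[of "?W n"] by auto
  from m(1) obtain v w where vw: "prefix_witness L v w" "length w = n" "length v = m"
    by blast
  have "minimal_prefix_witness L v w"
    unfolding minimal_prefix_witness_def using vw n(2) m(2) by blast
  then show ?thesis by blast
qed

end

theory Submission
  imports Defs
begin

text \<open>Let $s_0, \dots, s_{|w|}$ be the states visited on reading $w$, where $(v, w)$ is a minimal
  witness. If $s_i = s_j$ with $i < j < |w|$, cut the loop between $i$ and $j$ out of $w$. When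
  the end of $v$ lies outside the loop, the cut leaves a shorter witness. When it lies strictly inside,
  either $s_j$ is accepting, and $w$ may be truncated at $j$, or it is not, and the prefix of
  length $i$ is rejected and witnesses failure for the cut word. So $s_0, \dots, s_{|w|-1}$ are distinct.
  The bound is attained by the unary cycle of $n$ states, which accepts the words of length divisible by $n$.\<close>

lemma foldl_nxt_in_states:
  assumes "is_dfa M" "q \<in> states M" "w \<in> lists (alphabet M)"
  shows "foldl (nxt M) q w \<in> states M"
  using assms(2,3) by (induction w arbitrary: q) (use assms(1) in \<open>auto simp: is_dfa_def\<close>)

text \<open>Both words reach the same state just before the common suffix \<open>drop j w\<close>,
  so cutting out the loop does not change where the run ends.\<close>

lemma foldl_take_cut:
  assumes "foldl f s (take i w) = foldl f s (take j w)"
  shows "foldl f s (take i w @ drop j w) = foldl f s w"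
proof -
  have "foldl f s (take i w @ drop j w) = foldl f s (take j w @ drop j w)"
    using assms by (simp only: foldl_append)
  then show ?thesis by simp
qed

lemma minimal_prefix_witness_length_le:
  assumes "minimal_prefix_witness L v w" "prefix_witness L v' w'"
  shows "length w \<le> length w'"
  using assms unfolding minimal_prefix_witness_def by (meson not_le)

text \<open>The strict bound \<open>j < length w\<close> makes the truncation
  \<open>take j w\<close> shorter than \<open>w\<close>. The state reached by all of
  \<open>w\<close> may repeat an earlier one, as it does in the cycle automaton below.\<close>

lemma minimal_witness_states_distinct:
  assumes min: "minimal_prefix_witness (language M) v w"
    and ij: "i < j" "j < length w"
  shows "foldl (nxt M) (init M) (take i w) \<noteq> foldl (nxt M) (init M) (take j w)"
proof
  let ?run = "foldl (nxt M) (init M)"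
  assume eq: "?run (take i w) = ?run (take j w)"
  define w' where "w' = take i w @ drop j w"
  from min have w: "w \<in> lists (alphabet M)" "?run w \<in> final M"
    and v: "v \<notin> language M" "prefix v w"
    by (auto simp: minimal_prefix_witness_def prefix_witness_def language_def)
  have short: False if "prefix_witness (language M) x y" "length y < length w" for x y
    using minimal_prefix_witness_length_le[OF min that(1)] that(2) by simp
  define m where "m = length v"
  have vm: "v = take m w" and m: "m \<le> length w"
    using v(2) by (auto simp: m_def prefix_def)
  have lists: "take k w \<in> lists (alphabet M)" "drop k w \<in> lists (alphabet M)" for k
    using w(1) set_take_subset[of k w] set_drop_subset[of k w] by auto
  have vrun: "?run (take m w) \<notin> final M"
    using v(1) lists[of m] by (simp add: vm language_def)
  have len: "length w' < length w"
    using ij by (simp add: w'_def)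
  have w'L: "w' \<in> language M"
    using foldl_take_cut[OF eq] w(2) lists by (simp add: w'_def language_def)
  consider "m \<le> i" | "j \<le> m" | "i < m" "m < j" by linarith
  then show False
  proof cases
    case 1
    then have "prefix v w'"
      unfolding w'_def vm
      by (metis min.absorb1 prefix_prefix take_is_prefix take_take)
    with w'L v(1) have "prefix_witness (language M) v w'"
      by (simp add: prefix_witness_def)
    with len short show False by blast
  next
    case 2
    \<comment> \<open>Here \<open>v\<close> contains the whole loop, so the loop is cut out of
      \<open>v\<close> too. The result ends in the same rejecting state as \<open>v\<close>, since
      \<open>take m w\<close> and \<open>w\<close> agree on their prefixes of lengths
      \<open>i\<close> and \<open>j\<close>.\<close>
    define v' where "v' = take i w @ drop j (take m w)"
    have "?run v' = ?run (take m w)"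
      using foldl_take_cut[of "nxt M" "init M" i "take m w" j] eq 2 ij
      by (simp add: v'_def min_def)
    then have "v' \<notin> language M"
      using vrun by (simp add: language_def)
    moreover have "prefix v' w'"
      by (simp add: v'_def w'_def drop_take take_is_prefix)
    ultimately have "prefix_witness (language M) v' w'"
      using w'L by (simp add: prefix_witness_def)
    with len short show False by blast
  next
    case 3
    \<comment> \<open>The cut would remove the end of \<open>v\<close>, so \<open>v\<close> itself
      serves only if \<open>take j w\<close> is accepted. Otherwise \<open>eq\<close> carries the
      rejection back to \<open>take i w\<close>, which survives the cut.\<close>
    show False
    proof (cases "?run (take j w) \<in> final M")
      case True
      then have "take j w \<in> language M"
        using lists by (simp add: language_def)
      moreover have "prefix v (take j w)"
        using 3 by (metis vm less_imp_le min.absorb1 take_is_prefix take_take)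
      ultimately have "prefix_witness (language M) v (take j w)"
        using v(1) by (simp add: prefix_witness_def)
      with short[of v "take j w"] ij show False by simp
    next
      case False
      with eq have "take i w \<notin> language M" by (simp add: language_def)
      then have "prefix_witness (language M) (take i w) w'"
        using w'L by (simp add: prefix_witness_def w'_def)
      with len short show False by blast
    qed
  qed
qed

lemma minimal_witness_length_le_card:
  assumes M: "is_dfa M" and min: "minimal_prefix_witness (language M) v w"
  shows "length w \<le> card (states M)"
proof -
  let ?s = "\<lambda>i. foldl (nxt M) (init M) (take i w)"
  from min have w: "w \<in> lists (alphabet M)"
    by (simp add: minimal_prefix_witness_def prefix_witness_def language_def)
  have "inj_on ?s {..<length w}"
    using minimal_witness_states_distinct[OF min]
    by (intro linorder_inj_onI) auto
  moreover have "?s ` {..<length w} \<subseteq> states M"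
  proof (rule image_subsetI)
    fix i
    have "take i w \<in> lists (alphabet M)"
      using w set_take_subset[of i w] by auto
    then show "?s i \<in> states M"
      using foldl_nxt_in_states[OF M] M by (simp add: is_dfa_def)
  qed
  moreover have "finite (states M)"
    using M by (simp add: is_dfa_def)
  ultimately show ?thesis
    by (metis card_inj_on_le card_lessThan)
qed

definition cycle_dfa :: "nat \<Rightarrow> (nat, nat) dfa" where
  "cycle_dfa n =
     \<lparr>states = {..<n}, alphabet = {0}, nxt = (\<lambda>q a. Suc q mod n), init = 0, final = {0}\<rparr>"

lemma is_dfa_cycle_dfa: "n > 0 \<Longrightarrow> is_dfa (cycle_dfa n)"
  by (simp add: is_dfa_def cycle_dfa_def)

text \<open>Starting from \<open>q mod n\<close> keeps the induction going: one letter leads to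
  \<open>Suc q mod n\<close>, which has the same form.\<close>

lemma foldl_Suc_mod: "foldl (\<lambda>q a. Suc q mod n) (q mod n) w = (q + length w) mod n"
proof (induction w arbitrary: q)
  case (Cons a w)
  then show ?case using Cons.IH[of "Suc q"] by (simp add: mod_Suc_eq)
qed simp

lemma language_cycle_dfa: "language (cycle_dfa n) = {w \<in> lists {0}. n dvd length w}"
  by (auto simp: language_def cycle_dfa_def foldl_Suc_mod[of n 0, simplified])

text \<open>The word \<open>[0]\<close> is rejected because \<open>n \<ge> 2\<close> does not divide
  1. For \<open>n = 1\<close> the cycle accepts every word over its alphabet.\<close>

lemma prefix_witness_cycle_dfa:
  assumes "n \<ge> 2"
  shows "prefix_witness (language (cycle_dfa n)) [0] (replicate n 0)"
  using assms by (cases n) (auto simp: prefix_witness_def language_cycle_dfa)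

lemma prefix_witness_cycle_dfa_length_ge:
  assumes "prefix_witness (language (cycle_dfa n)) v w"
  shows "n \<le> length w"
proof -
  \<comment> \<open>The only prefix of \<open>[]\<close> is \<open>[]\<close>, which cannot be both
    accepted and rejected. This excludes length 0, the one multiple of \<open>n\<close> that could
    be below \<open>n\<close>.\<close>
  have "w \<noteq> []"
    using assms by (auto simp: prefix_witness_def)
  moreover have "n dvd length w"
    using assms by (simp add: prefix_witness_def language_cycle_dfa)
  ultimately show ?thesis by (auto intro: dvd_imp_le)
qed

lemma minimal_witness_cycle_dfa_length:
  assumes "n \<ge> 2" "minimal_prefix_witness (language (cycle_dfa n)) v w"
  shows "length w = n"
proof (rule antisym)
  show "length w \<le> n"
    using minimal_prefix_witness_length_le[OF assms(2) prefix_witness_cycle_dfa[OF assms(1)]]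
    by simp
  show "n \<le> length w"
    using assms(2) prefix_witness_cycle_dfa_length_ge
    unfolding minimal_prefix_witness_def by blast
qed

theorem theorem11:
  shows "(\<forall>(M :: ('q, 'a) dfa) n.
            is_dfa M \<and> card (states M) = n \<and> \<not> prefix_closed (language M) \<longrightarrow>
            (\<forall>v w. minimal_prefix_witness (language M) v w \<longrightarrow> length w \<le> n))
       \<and> (\<forall>n\<ge>2. \<exists>M :: (nat, nat) dfa.
            is_dfa M \<and> card (states M) = n \<and> \<not> prefix_closed (language M) \<and>
            (\<exists>v w. minimal_prefix_witness (language M) v w) \<and>
            (\<forall>v w. minimal_prefix_witness (language M) v w \<longrightarrow> length w = n))"
proof (intro conjI allI impI)
  fix M :: "('q, 'a) dfa" and n v w
  assume "is_dfa M \<and> card (states M) = n \<and> \<not> prefix_closed (language M)"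
    and "minimal_prefix_witness (language M) v w"
  then show "length w \<le> n"
    using minimal_witness_length_le_card by blast
next
  fix n :: nat
  assume n: "n \<ge> 2"
  let ?M = "cycle_dfa n"
  have not_closed: "\<not> prefix_closed (language ?M)"
    using prefix_witness_cycle_dfa[OF n] by (auto simp: prefix_closed_def prefix_witness_def)
  show "\<exists>M :: (nat, nat) dfa.
            is_dfa M \<and> card (states M) = n \<and> \<not> prefix_closed (language M) \<and>
            (\<exists>v w. minimal_prefix_witness (language M) v w) \<and>
            (\<forall>v w. minimal_prefix_witness (language M) v w \<longrightarrow> length w = n)"
  proof (intro exI[of _ ?M] conjI)
    show "is_dfa ?M" using n by (simp add: is_dfa_cycle_dfa)
    show "card (states ?M) = n" by (simp add: cycle_dfa_def)
    show "\<not> prefix_closed (language ?M)" by (fact not_closed)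
    \<comment> \<open>Existence keeps the claim about all minimal witnesses from being
      vacuous.\<close>
    show "\<exists>v w. minimal_prefix_witness (language ?M) v w"
      using not_closed by (rule minimal_prefix_witness_exists)
    show "\<forall>v w. minimal_prefix_witness (language ?M) v w \<longrightarrow> length w = n"
      using minimal_witness_cycle_dfa_length[OF n] by blast
  qed
qed

end
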